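(* Let $t$ be a positive integer and let $e_1=\langle\phi_1,\chi_1,\psi_1;r_1\rangle$ and $e_2=\langle\phi_2,\chi_2,\psi_2;r_2\rangle$ be two globular T-spherical fuzzy values (with respect to the exponent $t$). Then the cosine similarity measure $$S_{CS}(e_1,e_2)=\frac12\left\{\frac{\phi_1^t\phi_2^t+\chi_1^t\chi_2^t+\psi_1^t\psi_2^t}{\sqrt{\phi_1^{2t}+\chi_1^{2t}+\psi_1^{2t}}\,\sqrt{\phi_2^{2t}+\chi_2^{2t}+\psi_2^{2t}}}+1-|r_1-r_2|\right\}$$ satisfies: (i) $0\le S_{CS}(e_1,e_2)\le1$; (ii) $S_{CS}(e_1,e_2)=S_{CS}(e_2,e_1)$; (iii) $S_{CS}(e_1,e_2)=1$ if $e_1=e_2$.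
   Context: Fix a positive integer $t$. A globular T-spherical fuzzy value (G-TSFV) is a quadruple $\langle\phi,\chi,\psi;r\rangle$ with $\phi,\chi,\psi,r\in[0,1]$ and $\phi^t+\chi^t+\psi^t\le1$. Two G-TSFVs are equal iff all four components agree.
   Formalization: Part (iii) is proved for values whose components φ, χ, ψ are not all zero, since for ⟨0,0,0;r⟩ the quotient in the formula is 0/0 and undefined; in (i) and (ii) a quotient with zero denominator is read as 0. *)

theory Defs
  imports Complex_Main
begin

text \<open>
  The four components \<open>\<langle>\<phi>, \<chi>, \<psi>; r\<rangle>\<close>; the constraints, which depend on the exponent \<open>t\<close>,
  are imposed by the predicate \<open>is_gtsfv\<close>.
\<close>

datatype gtsf = GTSF (phi: real) (chi: real) (psi: real) (radius: real)

definition is_gtsfv :: "nat \<Rightarrow> gtsf \<Rightarrow> bool" where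
  "is_gtsfv t e \<longleftrightarrow>
     phi e \<in> {0..1} \<and> chi e \<in> {0..1} \<and> psi e \<in> {0..1} \<and> radius e \<in> {0..1} \<and>
     phi e ^ t + chi e ^ t + psi e ^ t \<le> 1"

text \<open>
  The quotient is mathematically undefined if \<open>\<phi> = \<chi> = \<psi> = 0\<close> for one of the arguments;
  with the HOL convention \<open>x / 0 = 0\<close> it then contributes \<open>0\<close>.
\<close>

definition S_CS :: "nat \<Rightarrow> gtsf \<Rightarrow> gtsf \<Rightarrow> real" where
  "S_CS t e1 e2 = 1 / 2 *
     ((phi e1 ^ t * phi e2 ^ t + chi e1 ^ t * chi e2 ^ t + psi e1 ^ t * psi e2 ^ t) /
        (sqrt (phi e1 ^ (2 * t) + chi e1 ^ (2 * t) + psi e1 ^ (2 * t)) *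
         sqrt (phi e2 ^ (2 * t) + chi e2 ^ (2 * t) + psi e2 ^ (2 * t)))
      + 1 - \<bar>radius e1 - radius e2\<bar>)"

end

theory Submission
  imports Defs
begin

text \<open>The quotient is the cosine of the angle between the vectors
  \<open>(phi^t, chi^t, psi^t)\<close> of the two values. These have nonnegative entries, so it is
  at least 0, and Cauchy-Schwarz bounds it by 1. \<open>S_CS\<close> averages it with
  \<open>1 - \<bar>r1 - r2\<bar>\<close>, also in [0,1]. For equal nonzero vectors the cosine is 1;
  the zero vector is excluded in (iii), since there 0/0 = 0 would give 1/2.\<close>

text \<open>By Lagrange's identity, the defect in the squared inequality is the squared length of
  the cross product.\<close>

lemma cauchy_schwarz_3:
  fixes a b c x y z :: real
  shows "a * x + b * y + c * z \<le> sqrt (a\<^sup>2 + b\<^sup>2 + c\<^sup>2) * sqrt (x\<^sup>2 + y\<^sup>2 + z\<^sup>2)"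
proof -
  have "(a\<^sup>2 + b\<^sup>2 + c\<^sup>2) * (x\<^sup>2 + y\<^sup>2 + z\<^sup>2) - (a * x + b * y + c * z)\<^sup>2
      = (a * y - b * x)\<^sup>2 + (a * z - c * x)\<^sup>2 + (b * z - c * y)\<^sup>2"
    by algebra
  then have "(a * x + b * y + c * z)\<^sup>2 \<le> (a\<^sup>2 + b\<^sup>2 + c\<^sup>2) * (x\<^sup>2 + y\<^sup>2 + z\<^sup>2)"
    by (smt (verit) zero_le_power2)
  then show ?thesis
    by (metis real_le_rsqrt real_sqrt_mult)
qed

theorem theorem5:
  fixes t :: nat and e1 e2 :: gtsf
  assumes "t > 0"
    and "is_gtsfv t e1"
    and "is_gtsfv t e2"
  shows "(0 \<le> S_CS t e1 e2 \<and> S_CS t e1 e2 \<le> 1) \<and>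
         S_CS t e1 e2 = S_CS t e2 e1 \<and>
         ((phi e1, chi e1, psi e1) \<noteq> (0, 0, 0) \<longrightarrow> e1 = e2 \<longrightarrow> S_CS t e1 e2 = 1)"
proof (intro conjI impI)
  define N where "N e = phi e ^ (2 * t) + chi e ^ (2 * t) + psi e ^ (2 * t)" for e
  define P where "P = phi e1 ^ t * phi e2 ^ t + chi e1 ^ t * chi e2 ^ t + psi e1 ^ t * psi e2 ^ t"
  have S: "S_CS t e1 e2 = 1 / 2 * (P / (sqrt (N e1) * sqrt (N e2)) + 1 - \<bar>radius e1 - radius e2\<bar>)"
    by (simp add: S_CS_def N_def P_def)
  \<comment> \<open>Shows \<open>N e\<close> as a squared Euclidean norm, the form Cauchy-Schwarz
    needs.\<close>
  have N_squares: "N e = (phi e ^ t)\<^sup>2 + (chi e ^ t)\<^sup>2 + (psi e ^ t)\<^sup>2" for e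
    by (simp add: N_def power_even_eq)
  have N_nonneg: "N e \<ge> 0" for e
    by (simp add: N_squares)
  have P_nonneg: "P \<ge> 0"
    using assms(2,3) by (simp add: P_def is_gtsfv_def)
  have "P \<le> sqrt (N e1) * sqrt (N e2)"
    unfolding P_def N_squares by (rule cauchy_schwarz_3)
  \<comment> \<open>\<open>0 \<le> P\<close> forces the denominator to be nonnegative; if it is 0,
    the quotient is 0 by convention.\<close>
  then have "P / (sqrt (N e1) * sqrt (N e2)) \<le> 1"
    using P_nonneg by (intro divide_le_eq_1[THEN iffD2]) linarith
  moreover have "P / (sqrt (N e1) * sqrt (N e2)) \<ge> 0"
    using P_nonneg N_nonneg by simp
  moreover have "\<bar>radius e1 - radius e2\<bar> \<le> 1"
    using assms(2,3) by (auto simp: is_gtsfv_def)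
  ultimately show "0 \<le> S_CS t e1 e2" "S_CS t e1 e2 \<le> 1"
    unfolding S by simp_all
  show "S_CS t e1 e2 = S_CS t e2 e1"
    by (simp add: S_CS_def mult.commute abs_minus_commute)
  assume nz: "(phi e1, chi e1, psi e1) \<noteq> (0, 0, 0)" and "e1 = e2"
  then have "P = N e1"
    by (simp add: P_def N_squares power2_eq_square)
  \<comment> \<open>A sum of squares vanishes only if every \<open>t\<close>-th power, hence every
    component, does.\<close>
  moreover have "N e1 \<noteq> 0"
    using nz by (auto simp: N_squares add_nonneg_eq_0_iff)
  ultimately show "S_CS t e1 e2 = 1"
    unfolding S using \<open>e1 = e2\<close> N_nonneg[of e1] by simp
qed

end
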